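(* Let $b>1$ be an odd integer. Then every positive rational number $q$ can be written as $$q=\frac{\varphi(m^{2})}{(\varphi(n^{2}))^{b}}$$ for some $m,n\in\mathbb{N}$.
   Context: $\mathbb{N}$ denotes the set of all positive integers. For $n\in\mathbb{N}$, $\varphi(n)$ is Euler's totient function, i.e. the number of positive integers up to $n$ that are relatively prime to $n$. *)

theory Defs
  imports Complex_Main "HOL-Number_Theory.Number_Theory"
begin

end

theory Submission
  imports Defs
begin

text \<open>
  If a prime \<open>p\<close> divides \<open>x\<close> exactly \<open>a > 0\<close> times, it contributes the odd power
  \<open>p ^ (2 * a - 1)\<close> and the factor \<open>p - 1\<close>, which only involves smaller primes, to
  \<open>\<phi>(x\<^sup>2)\<close>. So \<open>m\<close> and \<open>n\<close> can be built prime by prime from the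
  largest prime downwards, correcting the target \<open>q\<close> by powers of \<open>p - 1\<close> at each step. Let
  \<open>e\<close> be the exponent of \<open>p\<close> in the current target.

  \<^item> If \<open>e > 0\<close> is odd, put \<open>p\<close> into \<open>m\<close> only; the remaining target is
    divided by \<open>p - 1\<close> (\<open>representable_odd_step\<close>).
  \<^item> If \<open>e \<ge> 0\<close> is even, put \<open>p\<close> into both \<open>m\<close> and \<open>n\<close>; since
    \<open>b\<close> is odd, the parities fit, and the remaining target is multiplied by
    \<open>(p - 1) ^ (b - 1)\<close> (\<open>representable_even_step\<close>).

  Negative odd exponents are the obstacle, and the even step removes them. Let \<open>P\<close> bound the
  primes of \<open>q\<close>. Running the even step over all primes in \<open>{P<..N}\<close> multiplies the
  target by the \<open>(b - 1)\<close>-th power of the product of all \<open>p - 1\<close>. Because \<open>b - 1\<close> is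
  even, the exponents of primes above \<open>P\<close> stay even and nonnegative, so the even step remains
  applicable all the way down to \<open>P\<close>. For suitable \<open>N\<close> this factor is divisible by any
  prescribed number (\<open>exists_dvd_prod_prime_minus_1\<close>), because there are infinitely many primes
  congruent to 1 modulo a given prime. Hence what is left at \<open>P\<close> is a positive integer with
  all exponents of primes up to \<open>P\<close> large, and from there on the losses of the odd steps are
  harmless (\<open>representable_multiples\<close>).
\<close>

section \<open>Smooth numbers and representable targets\<close>

definition smooth :: "nat \<Rightarrow> nat \<Rightarrow> bool" where
  "smooth k x \<longleftrightarrow> x > 0 \<and> (\<forall>p. prime p \<longrightarrow> p dvd x \<longrightarrow> p \<le> k)"

text \<open>
  The smoothness bound leaves all primes above \<open>k\<close> free for extending \<open>m\<close> and
  \<open>n\<close>.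
\<close>
definition representable :: "nat \<Rightarrow> nat \<Rightarrow> rat \<Rightarrow> bool" where
  "representable b k q \<longleftrightarrow> (\<exists>m n. smooth k m \<and> smooth k n \<and>
     of_nat (totient (m ^ 2)) = q * of_nat (totient (n ^ 2)) ^ b)"

lemma smooth_mono: "smooth k x \<Longrightarrow> k \<le> l \<Longrightarrow> smooth l x"
  unfolding smooth_def by (meson le_trans)

lemma smooth_1 [simp]: "smooth k (Suc 0)"
  by (auto simp: smooth_def)

lemma smooth_self: "x > 0 \<Longrightarrow> smooth x x"
  by (auto simp: smooth_def dvd_imp_le)

lemma smooth_mult: "smooth k x \<Longrightarrow> smooth k y \<Longrightarrow> smooth k (x * y)"
  by (auto simp: smooth_def prime_dvd_mult_iff)

lemma smooth_power: "smooth k x \<Longrightarrow> smooth k (x ^ n)"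
  by (auto simp: smooth_def dest: prime_dvd_power)

lemma smooth_dvd: "smooth k x \<Longrightarrow> y dvd x \<Longrightarrow> smooth k y"
  unfolding smooth_def by (metis dvd_trans dvd_pos_nat)

lemma smooth_not_dvd: "smooth k x \<Longrightarrow> prime p \<Longrightarrow> k < p \<Longrightarrow> \<not> p dvd x"
  by (auto simp: smooth_def)

lemma smooth_prime_minus_1: "prime (Suc k) \<Longrightarrow> smooth k k"
  using prime_gt_1_nat[of "Suc k"] by (intro smooth_self) auto

lemma smooth_Suc_not_prime: "smooth (Suc k) x \<Longrightarrow> \<not> prime (Suc k) \<Longrightarrow> smooth k x"
  unfolding smooth_def by (metis le_SucE)

lemma smooth_Suc_decompose:
  assumes "smooth (Suc k) x" "prime (Suc k)"
  obtains e y where "x = Suc k ^ e * y" "smooth k y"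
proof -
  have "x \<noteq> 0" using assms(1) by (simp add: smooth_def)
  moreover have "\<not> is_unit (Suc k)" using assms(2) not_prime_unit by blast
  ultimately obtain y where y: "x = Suc k ^ multiplicity (Suc k) x * y" "\<not> Suc k dvd y"
    by (meson multiplicity_decompose')
  have "smooth (Suc k) y" using assms(1) y(1) smooth_dvd by (metis dvd_triv_right)
  then have "smooth k y" using y(2) unfolding smooth_def by (metis le_SucE)
  then show ?thesis using that y(1) by blast
qed

lemma representable_mono: "representable b k q \<Longrightarrow> k \<le> l \<Longrightarrow> representable b l q"
  unfolding representable_def using smooth_mono by blast

section \<open>Adding one prime\<close>

lemma totient_square_mult_prime_power:
  assumes "prime p" "\<not> p dvd m" "a > 0"
  shows "totient ((p ^ a * m)\<^sup>2) = p ^ (2 * a - 1) * (p - 1) * totient (m\<^sup>2)"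
proof -
  have "coprime (p ^ (2 * a)) (m\<^sup>2)"
    using assms by (simp add: prime_imp_coprime)
  then have "totient (p ^ (2 * a) * m\<^sup>2) = totient (p ^ (2 * a)) * totient (m\<^sup>2)"
    by (rule totient_mult_coprime)
  moreover have "totient (p ^ (2 * a)) = p ^ (2 * a - 1) * (p - 1)"
    using assms by (intro totient_prime_power) auto
  ultimately show ?thesis
    by (simp add: power_mult_distrib power_even_eq power_mult mult.commute)
qed

lemma representable_odd_step:
  assumes rep: "representable b k q" and p: "prime p" "k < p" and e: "odd e"
  shows "representable b p (q * of_nat (p - 1) * of_nat p ^ e)"
proof -
  obtain m n where mn: "smooth k m" "smooth k n"
    "of_nat (totient (m ^ 2)) = q * of_nat (totient (n ^ 2)) ^ b"
    using rep unfolding representable_def by blast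
  from e obtain h where h: "e = 2 * h + 1" by (elim oddE)
  have "totient ((p ^ Suc h * m)\<^sup>2) = p ^ (2 * Suc h - 1) * (p - 1) * totient (m\<^sup>2)"
    using mn p by (intro totient_square_mult_prime_power smooth_not_dvd) auto
  also have "2 * Suc h - 1 = e" using h by simp
  finally have "of_nat (totient ((p ^ Suc h * m)\<^sup>2))
      = (q * of_nat (p - 1) * of_nat p ^ e) * of_nat (totient (n ^ 2)) ^ b"
    using mn(3) by simp
  moreover have "smooth p (p ^ Suc h * m)" "smooth p n"
    using mn p by (auto intro!: smooth_mult smooth_power smooth_self
      intro: smooth_mono[OF _ less_imp_le] prime_gt_0_nat simp del: power_Suc)
  ultimately show ?thesis unfolding representable_def by blast
qed

text \<open>
  One factor \<open>p\<close> in \<open>n\<close> contributes \<open>(p * (p - 1)) ^ b\<close> to the denominator.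
  Since \<open>e + b\<close> is odd, \<open>m\<close> can supply exactly \<open>p ^ (e + b) * (p - 1)\<close>, which
  leaves \<open>p ^ e\<close> and a surplus of \<open>(p - 1) ^ (b - 1)\<close> in the denominator.
\<close>
lemma representable_even_step:
  assumes rep: "representable b k (q * of_nat (p - 1) ^ (b - 1))"
    and p: "prime p" "k < p" and e: "even e" and b: "odd b"
  shows "representable b p (q * of_nat p ^ e)"
proof -
  obtain m n where mn: "smooth k m" "smooth k n"
    "of_nat (totient (m ^ 2)) = q * of_nat (p - 1) ^ (b - 1) * of_nat (totient (n ^ 2)) ^ b"
    using rep unfolding representable_def by blast
  have "odd (e + b)" using e b by simp
  then obtain h where h: "e + b = 2 * h + 1" by (elim oddE)
  have "totient ((p ^ Suc h * m)\<^sup>2) = p ^ (2 * Suc h - 1) * (p - 1) * totient (m\<^sup>2)"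
    using mn p by (intro totient_square_mult_prime_power smooth_not_dvd) auto
  also have "2 * Suc h - 1 = e + b" using h by simp
  finally have tm: "totient ((p ^ Suc h * m)\<^sup>2) = p ^ (e + b) * (p - 1) * totient (m\<^sup>2)" .
  have "totient ((p ^ 1 * n)\<^sup>2) = p ^ (2 * 1 - 1) * (p - 1) * totient (n\<^sup>2)"
    using mn p by (intro totient_square_mult_prime_power smooth_not_dvd) auto
  then have tn: "totient ((p * n)\<^sup>2) = p * (p - 1) * totient (n\<^sup>2)" by simp
  have "b = Suc (b - 1)" using b by (cases b) auto
  then have pb: "(of_nat (p - 1) :: rat) ^ b = of_nat (p - 1) * of_nat (p - 1) ^ (b - 1)"
    by (metis power_Suc)
  have "of_nat (totient ((p ^ Suc h * m)\<^sup>2))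
      = of_nat p ^ (e + b) * of_nat (p - 1) * (of_nat (totient (m\<^sup>2)) :: rat)"
    by (simp only: tm of_nat_mult of_nat_power)
  also have "\<dots> = (q * of_nat p ^ e) * (of_nat p ^ b * of_nat (p - 1) ^ b * of_nat (totient (n\<^sup>2)) ^ b)"
    by (simp only: mn(3) pb power_add mult_ac)
  also have "\<dots> = (q * of_nat p ^ e) * of_nat (totient ((p * n)\<^sup>2)) ^ b"
    unfolding tn by (simp only: of_nat_mult power_mult_distrib)
  finally have "of_nat (totient ((p ^ Suc h * m)\<^sup>2))
      = (q * of_nat p ^ e) * of_nat (totient ((p * n)\<^sup>2)) ^ b" .
  moreover have "smooth p (p ^ Suc h * m)" "smooth p (p * n)"
    using mn p by (auto intro!: smooth_mult smooth_power smooth_self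
      intro: smooth_mono[OF _ less_imp_le] prime_gt_0_nat simp del: power_Suc)
  ultimately show ?thesis unfolding representable_def by blast
qed

section \<open>Integers with enough divisors\<close>

text \<open>
  The divisor \<open>D\<close> is a reserve: it gives each prime \<open>p \<le> k\<close> a positive exponent, so that
  the odd or the even step applies to it, and pays for the divisions by \<open>p - 1\<close> in the odd
  steps.
\<close>
lemma representable_multiples:
  assumes b: "odd b"
  shows "\<exists>D. smooth k D \<and> (\<forall>Q. smooth k Q \<longrightarrow> D dvd Q \<longrightarrow> representable b k (of_nat Q))"
proof (induction k)
  case 0
  have "representable b 0 (of_nat Q)" if "smooth 0 Q" for Q
  proof -
    have "Q = 1" using that prime_factor_nat[of Q] prime_gt_0_nat
      by (force simp: smooth_def)
    then show ?thesis unfolding representable_def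
      by (intro exI[of _ 1]) auto
  qed
  then show ?case using smooth_1 by blast
next
  case (Suc k)
  then obtain D where D: "smooth k D"
    "\<And>Q. smooth k Q \<Longrightarrow> D dvd Q \<Longrightarrow> representable b k (of_nat Q)" by blast
  show ?case
  proof (cases "prime (Suc k)")
    case False
    then show ?thesis using D
      by (meson smooth_Suc_not_prime smooth_mono le_SucI order_refl representable_mono)
  next
    case True
    define p where "p = Suc k"
    have p: "prime p" "k = p - 1" "k < p" using True by (auto simp: p_def)
    have k: "smooth k k" using True by (rule smooth_prime_minus_1)
    have "representable b p (of_nat Q)" if Q: "smooth p Q" "D * k * p dvd Q" for Q
    proof -
      obtain e R where R: "Q = p ^ e * R" "smooth k R"
        using smooth_Suc_decompose[of k Q] Q(1) True by (metis p_def)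
      have "coprime (D * k) (p ^ e)"
        using smooth_not_dvd[OF smooth_mult[OF D(1) k] p(1,3)] p(1)
        by (metis coprime_commute coprime_power_right_iff prime_imp_coprime)
      moreover have "D * k dvd p ^ e * R" using Q(2) R(1) by (meson dvd_mult_left)
      ultimately have DR: "D * k dvd R"
        by (simp add: coprime_dvd_mult_right_iff)
      show ?thesis
      proof (cases "even e")
        case True
        have "smooth k (R * k ^ (b - 1))" using R(2) k by (intro smooth_mult smooth_power)
        moreover have "D dvd R * k ^ (b - 1)" using DR by (meson dvd_mult2 dvd_mult_left)
        ultimately have "representable b k (of_nat (R * k ^ (b - 1)))" by (rule D(2))
        then have "representable b k (of_nat R * of_nat (p - 1) ^ (b - 1))"
          using p(2) by simp
        from representable_even_step[OF this p(1,3) True b]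
        show ?thesis using R(1) by (simp add: mult.commute)
      next
        case False
        from DR obtain R' where R': "R = D * k * R'" by (elim dvdE)
        have "smooth k (D * R')" using R(2) R' by (metis smooth_dvd dvd_triv_right mult.commute mult.assoc)
        then have "representable b k (of_nat (D * R'))" by (intro D(2)) auto
        from representable_odd_step[OF this p(1,3) False]
        have "representable b p (of_nat (D * R') * of_nat (p - 1) * of_nat p ^ e)" .
        also have "of_nat (D * R') * of_nat (p - 1) * of_nat p ^ e = (of_nat Q :: rat)"
          unfolding R(1) R' p(2)[symmetric] by (simp add: mult_ac)
        finally show ?thesis .
      qed
    qed
    moreover have "smooth p (D * k * p)"
      using D(1) k p by (intro smooth_mult smooth_self)
        (auto intro: smooth_mono[OF _ less_imp_le] prime_gt_0_nat)
    ultimately show ?thesis unfolding p_def by blast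
  qed
qed

section \<open>Products of predecessors of primes\<close>

text \<open>
  Any prime factor \<open>r\<close> of \<open>1 + x + \<dots> + x ^ (p - 1)\<close> is coprime to \<open>x\<close>, and the order of
  \<open>x\<close> modulo \<open>r\<close> divides \<open>p\<close>. Order 1 would mean that the sum is \<open>p\<close> modulo
  \<open>r\<close>, so \<open>r = p\<close>. A factorial \<open>x\<close> excludes this and makes \<open>r\<close> large; then the
  order is \<open>p\<close>, which divides \<open>r - 1\<close>.
\<close>
lemma exists_large_prime_cong_1:
  assumes p: "prime (p :: nat)"
  obtains r where "prime r" "r > X" "p dvd r - 1"
proof -
  define x :: nat where "x = fact (X + p)"
  define S where "S = (\<Sum>i<p. x ^ i)"
  have p2: "p \<ge> 2" using p by (rule prime_ge_2_nat)
  have x1: "x \<ge> 1" by (simp add: x_def)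
  have S_eq: "S = 1 + x * (\<Sum>i<p - 1. x ^ i)"
    using p2 by (cases p)
      (simp_all add: S_def sum.lessThan_Suc_shift sum_distrib_left del: sum.lessThan_Suc)
  have "(\<Sum>i<p - 1. x ^ i) \<noteq> 0" using p2 x1 by (auto intro!: exI[of _ 0])
  then have "S \<noteq> 1" using S_eq x1 by auto
  then obtain r where r: "prime r" "r dvd S" using prime_factor_nat by blast
  have "\<not> r dvd x"
  proof
    assume "r dvd x"
    then have "r dvd 1" using r(2) S_eq by (metis dvd_add_left_iff dvd_mult2)
    then show False using r(1) not_prime_unit by blast
  qed
  then have rX: "r > X + p" using r(1) unfolding x_def
    by (simp add: prime_dvd_fact_iff)
  have "int (x ^ p) - 1 = (int x - 1) * int S"
    unfolding S_def by (simp add: power_diff_1_eq)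
  then have "[int (x ^ p) = int 1] (mod int r)"
    using r(2) by (auto simp: cong_iff_dvd_diff)
  then have "[x ^ p = 1] (mod r)" by (simp only: cong_int_iff)
  then have "ord r x dvd p" by (simp only: ord_divides)
  moreover have "ord r x \<noteq> 1"
  proof
    assume "ord r x = 1"
    then have "[x = 1] (mod r)" by (simp add: ord_eq_Suc_0_iff)
    then have "[S = (\<Sum>i<p. 1 ^ i)] (mod r)"
      unfolding S_def by (intro cong_sum cong_pow)
    then have "r dvd p" using r(2) by (simp add: cong_dvd_iff)
    then show False using rX p2 dvd_imp_le[of r p] by auto
  qed
  ultimately have "ord r x = p" using p by (auto simp: prime_nat_iff)
  moreover have "ord r x dvd totient r"
    using \<open>\<not> r dvd x\<close> r(1) by (simp add: order_divides_totient prime_imp_coprime)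
  ultimately show ?thesis using that[of r] r(1) rX by (simp add: totient_prime)
qed

definition prod_prime_minus_1 :: "nat \<Rightarrow> nat \<Rightarrow> nat" where
  "prod_prime_minus_1 P N = (\<Prod>p | prime p \<and> p \<in> {P<..N}. p - 1)"

lemma prod_prime_minus_1_self [simp]: "prod_prime_minus_1 P P = 1"
  by (simp add: prod_prime_minus_1_def)

lemma prod_prime_minus_1_Suc:
  assumes "P \<le> N"
  shows "prod_prime_minus_1 P (Suc N) =
    (if prime (Suc N) then N * prod_prime_minus_1 P N else prod_prime_minus_1 P N)"
proof (cases "prime (Suc N)")
  case True
  have "{p. prime p \<and> p \<in> {P<..Suc N}} = insert (Suc N) {p. prime p \<and> p \<in> {P<..N}}"
    using True assms by auto
  then show ?thesis using True by (simp add: prod_prime_minus_1_def)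
next
  case False
  then have "{p. prime p \<and> p \<in> {P<..Suc N}} = {p. prime p \<and> p \<in> {P<..N}}"
    by (auto simp: le_Suc_eq)
  then show ?thesis using False by (simp add: prod_prime_minus_1_def)
qed

lemma prod_prime_minus_1_dvd:
  assumes "P \<le> N" "N < r" "prime r"
  shows "prod_prime_minus_1 P N * (r - 1) dvd prod_prime_minus_1 P r"
proof -
  have "prod_prime_minus_1 P N * (r - 1) = (\<Prod>p\<in>insert r {p. prime p \<and> p \<in> {P<..N}}. p - 1)"
    using assms by (simp add: prod_prime_minus_1_def)
  also have "\<dots> dvd prod_prime_minus_1 P r"
    unfolding prod_prime_minus_1_def using assms by (intro prod_dvd_prod_subset) auto
  finally show ?thesis .
qed

text \<open>
  Each prime factor of \<open>E\<close>, counted with multiplicity, is provided by a new and larger prime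
  \<open>r\<close>; so primes congruent to 1 modulo a prime suffice.
\<close>
lemma exists_dvd_prod_prime_minus_1:
  assumes "E > 0"
  shows "\<exists>N\<ge>P. E dvd prod_prime_minus_1 P N"
  using assms
proof (induction E rule: prime_divisors_induct)
  case zero
  then show ?case by simp
next
  case (unit x)
  then show ?case by auto
next
  case (factor p x)
  then obtain N where N: "N \<ge> P" "x dvd prod_prime_minus_1 P N" by auto
  obtain r where r: "prime r" "r > N" "p dvd r - 1"
    using factor.hyps exists_large_prime_cong_1 by blast
  have "x * p dvd prod_prime_minus_1 P N * (r - 1)" using N r by (intro mult_dvd_mono)
  also have "\<dots> dvd prod_prime_minus_1 P r" using N r by (intro prod_prime_minus_1_dvd)
  finally show ?case using N r by (intro exI[of _ r]) (auto simp: mult.commute)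
qed

section \<open>Descent through the large primes\<close>

text \<open>
  Since \<open>b - 1 = 2 * h\<close>, the targets met on the way down all have the form \<open>q * t\<^sup>2\<close>: the
  even step at \<open>p\<close> replaces \<open>t\<close>, with its powers of \<open>p\<close> removed, by
  \<open>t * (p - 1) ^ h\<close>. The hypothesis \<open>divides\<close> says that \<open>t\<close> and the factors still to
  be collected above \<open>P\<close> supply \<open>E\<close> in the end; removing powers of \<open>p > P\<close> does
  not affect this, as \<open>E\<close> has no such prime factor.
\<close>
lemma representable_descent:
  assumes b: "b = 2 * h + 1" and E: "smooth P E"
    and base: "\<And>t. smooth P t \<Longrightarrow> E dvd t \<Longrightarrow> representable b P (q * of_nat t ^ 2)"
    and "P \<le> N" and "smooth N t"
    and divides: "E dvd t * prod_prime_minus_1 P N ^ h"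
  shows "representable b N (q * of_nat t ^ 2)"
  using assms(4-6)
proof (induction N arbitrary: t rule: dec_induct)
  case base
  then show ?case using assms(3) by simp
next
  case (step N)
  show ?case
  proof (cases "prime (Suc N)")
    case False
    then have "representable b N (q * of_nat t ^ 2)"
      using step smooth_Suc_not_prime by (simp add: prod_prime_minus_1_Suc)
    then show ?thesis by (rule representable_mono) simp
  next
    case True
    define p where "p = Suc N"
    have p: "prime p" "N = p - 1" "N < p" using True by (auto simp: p_def)
    obtain f s where s: "t = p ^ f * s" "smooth N s"
      using smooth_Suc_decompose[OF step.prems(1) True] by (metis p_def)
    have "coprime E (p ^ f)"
      using smooth_not_dvd[OF E p(1)] step.hyps p(1,3)
      by (metis coprime_commute coprime_power_right_iff prime_imp_coprime le_less_trans)
    moreover have "E dvd p ^ f * (s * N ^ h * prod_prime_minus_1 P N ^ h)"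
      using step.prems(2) s(1) True step.hyps
      by (simp add: prod_prime_minus_1_Suc power_mult_distrib mult_ac)
    ultimately have "E dvd (s * N ^ h) * prod_prime_minus_1 P N ^ h"
      by (simp add: coprime_dvd_mult_right_iff)
    moreover have "smooth N (s * N ^ h)"
      using s(2) True by (intro smooth_mult smooth_power smooth_prime_minus_1)
    ultimately have "representable b N (q * of_nat (s * N ^ h) ^ 2)"
      by (intro step.IH)
    moreover have "q * of_nat (s * N ^ h) ^ 2 = q * of_nat s ^ 2 * of_nat (p - 1) ^ (b - 1)"
      using b p(2) by (simp add: power_mult_distrib mult.commute flip: power_mult)
    ultimately have "representable b N (q * of_nat s ^ 2 * of_nat (p - 1) ^ (b - 1))" by (simp only:)
    then have "representable b p (q * of_nat s ^ 2 * of_nat p ^ (2 * f))"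
      using p b by (intro representable_even_step) auto
    moreover have "q * of_nat s ^ 2 * of_nat p ^ (2 * f) = q * of_nat t ^ 2"
      unfolding s(1) by (simp add: power_mult_distrib mult_ac flip: power_mult)
    ultimately show ?thesis by (simp only: p_def)
  qed
qed

section \<open>Every positive rational is represented\<close>

theorem theorem1p1:
  fixes b :: nat and q :: rat
  assumes "b > 1" and "odd b" and "q > 0"
  shows "\<exists>m n :: nat. m > 0 \<and> n > 0 \<and>
           q = of_nat (totient (m ^ 2)) / (of_nat (totient (n ^ 2))) ^ b"
proof -
  from assms(2) obtain h where h: "b = 2 * h + 1" by (elim oddE)
  then have "h > 0" using assms(1) by simp
  obtain A' B' where AB': "q = of_int A' / of_int B'" "B' > 0"
    by (metis quotient_of_div quotient_of_denom_pos surj_pair)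
  then have "A' > 0" using assms(3) by (simp add: zero_less_divide_iff)
  define A B where "A = nat A'" and "B = nat B'"
  have AB: "q = of_nat A / of_nat B" "A > 0" "B > 0"
    using AB' \<open>A' > 0\<close> by (auto simp: A_def B_def)
  define P where "P = max A B"
  have AP: "smooth P A" "smooth P B"
    using AB by (auto simp: P_def intro: smooth_mono smooth_self)
  obtain D where D: "smooth P D"
    "\<And>Q. smooth P Q \<Longrightarrow> D dvd Q \<Longrightarrow> representable b P (of_nat Q)"
    using representable_multiples[OF assms(2)] by blast
  \<comment> \<open>One \<open>B\<close> of \<open>E\<^sup>2\<close> clears the denominator and \<open>D\<close> makes the result admissible:
    \<open>q * E\<^sup>2 = A * B * D\<^sup>2\<close>.\<close>
  define E where "E = B * D"
  have E: "smooth P E" unfolding E_def using AP D by (intro smooth_mult)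
  have base: "representable b P (q * of_nat t ^ 2)" if t: "smooth P t" "E dvd t" for t
  proof -
    obtain u where u: "t = E * u" using t(2) by (elim dvdE)
    have "smooth P u" using t(1) u smooth_dvd by (metis dvd_triv_right)
    then have "representable b P (of_nat (A * B * D ^ 2 * u ^ 2))"
      using AP D(1) by (intro D(2) smooth_mult smooth_power) (auto simp: power2_eq_square)
    moreover have "of_nat (A * B * D ^ 2 * u ^ 2) = q * of_nat t ^ 2"
      unfolding u E_def AB(1) using AB(3) by (simp add: field_simps power2_eq_square)
    ultimately show ?thesis by simp
  qed
  have "E > 0" using E by (simp add: smooth_def)
  then obtain N where N: "N \<ge> P" "E dvd prod_prime_minus_1 P N"
    using exists_dvd_prod_prime_minus_1 by blast
  have "prod_prime_minus_1 P N dvd prod_prime_minus_1 P N ^ h"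
    using \<open>h > 0\<close> by (simp add: dvd_power)
  then have "E dvd 1 * prod_prime_minus_1 P N ^ h" using N(2) by (simp add: dvd_trans)
  from representable_descent[OF h E base N(1) _ this]
  have "representable b N q" by simp
  then obtain m n where mn: "m > 0" "n > 0"
    "of_nat (totient (m ^ 2)) = q * of_nat (totient (n ^ 2)) ^ b"
    unfolding representable_def smooth_def by blast
  have "(of_nat (totient (n ^ 2)) :: rat) ^ b \<noteq> 0" using mn(2) by simp
  then have "q = of_nat (totient (m ^ 2)) / (of_nat (totient (n ^ 2))) ^ b"
    using mn(3) by (simp add: field_simps)
  then show ?thesis using mn(1,2) by blast
qed

end
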